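(* There is a universal constant $C>0$ such that for every $d\in\mathbb{N}$ and every $b\in\mathbb{R}^d$, the Active Set Algorithm (described in the context) on input $(d,b)$ outputs the optimal solution of $$\min_{x\in\mathbb{R}^d}\ \tfrac12 x^\top Q_d x+b^\top x\quad\text{subject to } x\le \mathbf{0}_d$$ using at most $C d^2$ time; i.e. the algorithm solves this problem in $O(d^2)$ time.
   Context: $\mathbb{N}$ is the set of positive integers. For $m\ge 1$, $Q_m:=2\mathrm{I}_m+2\mathrm{J}_m\in\mathbb{R}^{m\times m}$, where $\mathrm{I}_m$ is the identity matrix and $\mathrm{J}_m$ is the all-ones matrix; $Q_m$ is symmetric positive definite with $Q_m^{-1}=\frac12\left(\mathrm{I}_m-\frac1{1+m}\mathrm{J}_m\right)$, and products $Q_m^{-1}v$ are evaluated with this formula. Vector inequalities are entrywise. For $F\subseteq\{1,\dots,d\}$, $b_F\in\mathbb{R}^{|F|}$ is the subvector of $b$ with indices in $F$; vectors in $\mathbb{R}^{|F|}$ are indexed by the elements of $F$. If $F=\emptyset$, then $-Q_{|F|}^{-1}b_F$ is the empty vector. Time is the number of elementary operations (real arithmetic operations, comparisons, assignments), each of unit cost. Active Set Algorithm (input $d,b$): 1. Set $x^\ast:=\mathbf{0}_d$, $B_1:=\emptyset$, $F_0:=\emptyset$, $F_1:=\{1,\dots,d\}$, $k:=1$. 2. While $|F_{k-1}|\ne|F_k|$: set $y:=-Q_{|F_k|}^{-1}b_{F_k}$ (indexed by $F_k$); set $F_{k+1}:=F_k\setminus\{i\in F_k: y_i>0\}$ and $B_{k+1}:=B_k\cup\{i\in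 F_k:y_i>0\}$; replace $k$ by $k+1$. 3. When the loop ends, set $x^\ast_{F_k}:=y$ (the last computed $y$) and output $x^\ast$ (the other entries remain $0$). *)

theory Defs
  imports
    Complex_Main
    "HOL-Library.While_Combinator"
    "Jordan_Normal_Form.Matrix"
    "Jordan_Normal_Form.DL_Missing_Sublist"
begin

text \<open>
  Coordinates are numbered from 0, so the index set \<open>{1,...,d}\<close> becomes \<open>{..<d}\<close>.
\<close>

section \<open>The optimisation problem\<close>

definition J_mat :: "nat \<Rightarrow> real mat" where
  "J_mat m = mat m m (\<lambda>_. 1)"

definition Q_mat :: "nat \<Rightarrow> real mat" where
  "Q_mat m = 2 \<cdot>\<^sub>m 1\<^sub>m m + 2 \<cdot>\<^sub>m J_mat m"

definition Q_inv :: "nat \<Rightarrow> real mat" where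
  "Q_inv m = (1/2) \<cdot>\<^sub>m (1\<^sub>m m - (1 / (1 + real m)) \<cdot>\<^sub>m J_mat m)"

lemma J_mat_square: "J_mat m * J_mat m = real m \<cdot>\<^sub>m J_mat m"
  by (intro eq_matI) (auto simp: J_mat_def scalar_prod_def)

lemma Q_mat_Q_inv: "Q_mat m * Q_inv m = 1\<^sub>m m" "Q_inv m * Q_mat m = 1\<^sub>m m"
proof -
  have carr: "J_mat m \<in> carrier_mat m m" by (simp add: J_mat_def)
  define a where "a = 1 / (1 + real m)"
  have a: "a * (1 + real m) = 1" by (simp add: a_def)
  have entry: "(J_mat m * J_mat m) $$ (i, j) = real m" if "i < m" "j < m" for i j
    using that unfolding J_mat_square by (simp add: J_mat_def)
  have "Q_mat m * Q_inv m
      = (2 \<cdot>\<^sub>m 1\<^sub>m m + 2 \<cdot>\<^sub>m J_mat m) * ((1/2) \<cdot>\<^sub>m 1\<^sub>m m - (a/2) \<cdot>\<^sub>m J_mat m)"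
    using carr by (auto simp: Q_mat_def Q_inv_def a_def intro!: arg_cong2[where f = "(*)"] eq_matI)
      (auto simp: field_simps)
  also have "\<dots> = 1\<^sub>m m + J_mat m - a \<cdot>\<^sub>m J_mat m - a \<cdot>\<^sub>m (J_mat m * J_mat m)"
  proof -
    have "(2 \<cdot>\<^sub>m 1\<^sub>m m + 2 \<cdot>\<^sub>m J_mat m) * ((1/2) \<cdot>\<^sub>m 1\<^sub>m m - (a/2) \<cdot>\<^sub>m J_mat m)
       = (2 \<cdot>\<^sub>m 1\<^sub>m m + 2 \<cdot>\<^sub>m J_mat m) * ((1/2) \<cdot>\<^sub>m 1\<^sub>m m)
         - (2 \<cdot>\<^sub>m 1\<^sub>m m + 2 \<cdot>\<^sub>m J_mat m) * ((a/2) \<cdot>\<^sub>m J_mat m)"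
      using carr by (intro mult_minus_distrib_mat) auto
    also have "(2 \<cdot>\<^sub>m 1\<^sub>m m + 2 \<cdot>\<^sub>m J_mat m) * ((1/2) \<cdot>\<^sub>m 1\<^sub>m m) = 1\<^sub>m m + J_mat m"
    proof -
      have "(2 \<cdot>\<^sub>m 1\<^sub>m m + 2 \<cdot>\<^sub>m J_mat m) * ((1/2) \<cdot>\<^sub>m 1\<^sub>m m)
          = (1/2) \<cdot>\<^sub>m ((2 \<cdot>\<^sub>m 1\<^sub>m m + 2 \<cdot>\<^sub>m J_mat m) * 1\<^sub>m m)"
        using carr by (intro mult_smult_distrib) auto
      also have "\<dots> = 1\<^sub>m m + J_mat m" using carr by (intro eq_matI) auto
      finally show ?thesis .
    qed
    also have "(2 \<cdot>\<^sub>m 1\<^sub>m m + 2 \<cdot>\<^sub>m J_mat m) * ((a/2) \<cdot>\<^sub>m J_mat m)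
        = a \<cdot>\<^sub>m J_mat m + a \<cdot>\<^sub>m (J_mat m * J_mat m)"
    proof -
      have "(2 \<cdot>\<^sub>m 1\<^sub>m m + 2 \<cdot>\<^sub>m J_mat m) * ((a/2) \<cdot>\<^sub>m J_mat m)
          = (2 \<cdot>\<^sub>m 1\<^sub>m m) * ((a/2) \<cdot>\<^sub>m J_mat m) + (2 \<cdot>\<^sub>m J_mat m) * ((a/2) \<cdot>\<^sub>m J_mat m)"
        using carr by (intro add_mult_distrib_mat) auto
      also have "(2 \<cdot>\<^sub>m 1\<^sub>m m) * ((a/2) \<cdot>\<^sub>m J_mat m) = 2 \<cdot>\<^sub>m (1\<^sub>m m * ((a/2) \<cdot>\<^sub>m J_mat m))"
        using carr by (intro mult_smult_assoc_mat) auto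
      also have "(2 \<cdot>\<^sub>m J_mat m) * ((a/2) \<cdot>\<^sub>m J_mat m) = 2 \<cdot>\<^sub>m (J_mat m * ((a/2) \<cdot>\<^sub>m J_mat m))"
        using carr by (intro mult_smult_assoc_mat) auto
      also have "J_mat m * ((a/2) \<cdot>\<^sub>m J_mat m) = (a/2) \<cdot>\<^sub>m (J_mat m * J_mat m)"
        using carr by (intro mult_smult_distrib) auto
      finally show ?thesis using carr by (auto intro!: eq_matI)
    qed
    finally show ?thesis using carr by (auto intro!: eq_matI)
  qed
  also have "\<dots> = 1\<^sub>m m"
  proof (rule eq_matI)
    fix i j assume ij: "i < dim_row (1\<^sub>m m :: real mat)" "j < dim_col (1\<^sub>m m :: real mat)"
    then have "(1\<^sub>m m + J_mat m - a \<cdot>\<^sub>m J_mat m - a \<cdot>\<^sub>m (J_mat m * J_mat m)) $$ (i, j)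
        = (1\<^sub>m m $$ (i, j) + 1 - a) - a * real m"
      using carr unfolding J_mat_square by (simp add: J_mat_def)
    also have "\<dots> = 1\<^sub>m m $$ (i, j)" using a by (simp add: algebra_simps)
    finally show "(1\<^sub>m m + J_mat m - a \<cdot>\<^sub>m J_mat m - a \<cdot>\<^sub>m (J_mat m * J_mat m)) $$ (i, j)
        = 1\<^sub>m m $$ (i, j)" .
  qed (use carr in auto)
  finally show QQ: "Q_mat m * Q_inv m = 1\<^sub>m m" .
  show "Q_inv m * Q_mat m = 1\<^sub>m m"
  proof -
    have tr: "Q_mat m \<in> carrier_mat m m" "Q_inv m \<in> carrier_mat m m"
      "(Q_mat m)\<^sup>T = Q_mat m" "(Q_inv m)\<^sup>T = Q_inv m"
      by (auto simp: Q_mat_def Q_inv_def J_mat_def intro!: eq_matI)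
    have "Q_inv m * Q_mat m = (Q_mat m * Q_inv m)\<^sup>T"
      using transpose_mult[OF tr(1,2)] tr(3,4) by simp
    then show ?thesis by (simp add: QQ)
  qed
qed

definition objective :: "nat \<Rightarrow> real vec \<Rightarrow> real vec \<Rightarrow> real" where
  "objective d b x = 1/2 * (x \<bullet> (Q_mat d *\<^sub>v x)) + b \<bullet> x"

definition optimal_solution :: "nat \<Rightarrow> real vec \<Rightarrow> real vec \<Rightarrow> bool" where
  "optimal_solution d b x \<longleftrightarrow>
     x \<in> carrier_vec d \<and> x \<le> 0\<^sub>v d \<and>
     (\<forall>z \<in> carrier_vec d. z \<le> 0\<^sub>v d \<longrightarrow> objective d b x \<le> objective d b z)"

section \<open>The Active Set Algorithm on sets and vectors\<close>

text \<open>
  A vector indexed by a finite set \<open>F\<close> is stored with the elements of \<open>F\<close> in increasing order: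
  \<open>pick F k\<close> is the \<open>k\<close>-th smallest element of \<open>F\<close>, and \<open>i \<in> F\<close> sits at position
  \<open>card {j \<in> F. j < i}\<close>.
\<close>

definition sub_vec :: "real vec \<Rightarrow> nat set \<Rightarrow> real vec" where
  "sub_vec b F = vec (card F) (\<lambda>k. b $ pick F k)"

definition entry_at :: "nat set \<Rightarrow> real vec \<Rightarrow> nat \<Rightarrow> real" where
  "entry_at F v i = v $ card {j \<in> F. j < i}"

text \<open>
  The loop state is \<open>(F', F, B, y)\<close> with \<open>F' = F\<^bsub>k-1\<^esub>\<close>, \<open>F = F\<^sub>k\<close>, \<open>B = B\<^sub>k\<close> and \<open>y\<close> the vector
  computed last, indexed by \<open>F'\<close>.  When the loop ends \<open>F' = F\<close>, so \<open>y\<close> is then indexed by \<open>F\<close>.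
\<close>

definition active_set :: "nat \<Rightarrow> real vec \<Rightarrow> real vec option" where
  "active_set d b =
     map_option (\<lambda>(F', F, B, y). vec d (\<lambda>i. if i \<in> F then entry_at F y i else 0))
       (while_option
          (\<lambda>(F', F, B, y). card F' \<noteq> card F)
          (\<lambda>(F', F, B, y).
             let y' = - (Q_inv (card F) *\<^sub>v sub_vec b F);
                 P = {i \<in> F. entry_at F y' i > 0}
             in (F, F - P, B \<union> P, y'))
          ({}, {..<d}, {}, vNil))"

section \<open>A unit-cost random access machine\<close>

text \<open>
  Memory consists of natural number variables (used for counters and indices), real variables, and
  real arrays.  Every arithmetic operation, comparison and assignment costs one unit, including
  those on counters and indices; reading a literal, a variable or an array cell is part of the
  operation that uses the value.
\<close>

type_synonym vname = string

record state =
  nat_var :: "vname \<Rightarrow> nat"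
  real_var :: "vname \<Rightarrow> real"
  arr :: "vname \<Rightarrow> nat \<Rightarrow> real"

datatype nexp = NLit nat | NVar vname | NPlus nexp nexp

datatype rexp = RLit real | RVar vname | RArr vname nexp | RNeg rexp
  | RPlus rexp rexp | RMinus rexp rexp | RTimes rexp rexp | RDiv rexp rexp

datatype bexp = NLess nexp nexp | RLess rexp rexp | RNeq rexp rexp

datatype com = Skip (\<open>SKIP\<close>)
  | NAssign vname nexp (\<open>_ :=\<^sub>N _\<close> [1000, 61] 61)
  | RAssign vname rexp (\<open>_ :=\<^sub>R _\<close> [1000, 61] 61)
  | AAssign vname nexp rexp (\<open>_\<langle>_\<rangle> :=\<^sub>R _\<close> [1000, 0, 61] 61)
  | Seq com com (\<open>_;;/ _\<close> [60, 61] 60)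
  | Cond bexp com com (\<open>(IF _/ THEN _/ ELSE _)\<close> [0, 0, 61] 61)
  | While bexp com (\<open>(WHILE _/ DO _)\<close> [0, 61] 61)

fun nval :: "nexp \<Rightarrow> state \<Rightarrow> nat" where
  "nval (NLit n) s = n"
| "nval (NVar x) s = nat_var s x"
| "nval (NPlus e f) s = nval e s + nval f s"

fun rval :: "rexp \<Rightarrow> state \<Rightarrow> real" where
  "rval (RLit r) s = r"
| "rval (RVar x) s = real_var s x"
| "rval (RArr a e) s = arr s a (nval e s)"
| "rval (RNeg e) s = - rval e s"
| "rval (RPlus e f) s = rval e s + rval f s"
| "rval (RMinus e f) s = rval e s - rval f s"
| "rval (RTimes e f) s = rval e s * rval f s"
| "rval (RDiv e f) s = rval e s / rval f s"

fun bval :: "bexp \<Rightarrow> state \<Rightarrow> bool" where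
  "bval (NLess e f) s \<longleftrightarrow> nval e s < nval f s"
| "bval (RLess e f) s \<longleftrightarrow> rval e s < rval f s"
| "bval (RNeq e f) s \<longleftrightarrow> rval e s \<noteq> rval f s"

fun ncost :: "nexp \<Rightarrow> nat" where
  "ncost (NLit n) = 0"
| "ncost (NVar x) = 0"
| "ncost (NPlus e f) = ncost e + ncost f + 1"

fun rcost :: "rexp \<Rightarrow> nat" where
  "rcost (RLit r) = 0"
| "rcost (RVar x) = 0"
| "rcost (RArr a e) = ncost e"
| "rcost (RNeg e) = rcost e + 1"
| "rcost (RPlus e f) = rcost e + rcost f + 1"
| "rcost (RMinus e f) = rcost e + rcost f + 1"
| "rcost (RTimes e f) = rcost e + rcost f + 1"
| "rcost (RDiv e f) = rcost e + rcost f + 1"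

fun bcost :: "bexp \<Rightarrow> nat" where
  "bcost (NLess e f) = ncost e + ncost f + 1"
| "bcost (RLess e f) = rcost e + rcost f + 1"
| "bcost (RNeq e f) = rcost e + rcost f + 1"

text \<open>\<open>(c, s) \<Rightarrow> t \<Down> s'\<close>: started in \<open>s\<close>, the command \<open>c\<close> terminates in \<open>s'\<close> after time \<open>t\<close>.\<close>

inductive exec :: "com \<times> state \<Rightarrow> nat \<Rightarrow> state \<Rightarrow> bool" (\<open>_ \<Rightarrow> _ \<Down> _\<close> [56, 56, 56] 55) where
  Skip: "(SKIP, s) \<Rightarrow> 0 \<Down> s"
| NAssign: "(x :=\<^sub>N e, s) \<Rightarrow> ncost e + 1 \<Down> s\<lparr>nat_var := (nat_var s)(x := nval e s)\<rparr>"
| RAssign: "(x :=\<^sub>R e, s) \<Rightarrow> rcost e + 1 \<Down> s\<lparr>real_var := (real_var s)(x := rval e s)\<rparr>"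
| AAssign: "(a\<langle>i\<rangle> :=\<^sub>R e, s) \<Rightarrow> ncost i + rcost e + 1
    \<Down> s\<lparr>arr := (arr s)(a := (arr s a)(nval i s := rval e s))\<rparr>"
| Seq: "(c1, s1) \<Rightarrow> t1 \<Down> s2 \<Longrightarrow> (c2, s2) \<Rightarrow> t2 \<Down> s3 \<Longrightarrow> (c1;; c2, s1) \<Rightarrow> t1 + t2 \<Down> s3"
| CondTrue: "bval p s \<Longrightarrow> (c1, s) \<Rightarrow> t \<Down> s' \<Longrightarrow> (IF p THEN c1 ELSE c2, s) \<Rightarrow> bcost p + t \<Down> s'"
| CondFalse: "\<not> bval p s \<Longrightarrow> (c2, s) \<Rightarrow> t \<Down> s' \<Longrightarrow> (IF p THEN c1 ELSE c2, s) \<Rightarrow> bcost p + t \<Down> s'"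
| WhileFalse: "\<not> bval p s \<Longrightarrow> (WHILE p DO c, s) \<Rightarrow> bcost p \<Down> s"
| WhileTrue: "bval p s1 \<Longrightarrow> (c, s1) \<Rightarrow> t1 \<Down> s2 \<Longrightarrow> (WHILE p DO c, s2) \<Rightarrow> t2 \<Down> s3 \<Longrightarrow>
    (WHILE p DO c, s1) \<Rightarrow> bcost p + t1 + t2 \<Down> s3"

inductive_cases SkipE: "(SKIP, s) \<Rightarrow> t \<Down> s'"
inductive_cases NAssignE: "(x :=\<^sub>N e, s) \<Rightarrow> t \<Down> s'"
inductive_cases RAssignE: "(x :=\<^sub>R e, s) \<Rightarrow> t \<Down> s'"
inductive_cases AAssignE: "(a\<langle>i\<rangle> :=\<^sub>R e, s) \<Rightarrow> t \<Down> s'"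
inductive_cases SeqE: "(c1;; c2, s) \<Rightarrow> t \<Down> s'"
inductive_cases CondE: "(IF p THEN c1 ELSE c2, s) \<Rightarrow> t \<Down> s'"
inductive_cases WhileE: "(WHILE p DO c, s) \<Rightarrow> t \<Down> s'"

lemma exec_deterministic: "cs \<Rightarrow> t \<Down> s' \<Longrightarrow> cs \<Rightarrow> u \<Down> r' \<Longrightarrow> u = t \<and> r' = s'"
proof (induction arbitrary: u r' rule: exec.induct)
  case Seq then show ?case by (metis SeqE)
next
  case CondTrue then show ?case by (metis CondE)
next
  case CondFalse then show ?case by (metis CondE)
next
  case WhileFalse then show ?case by (metis WhileE)
next
  case WhileTrue from WhileTrue.prems show ?case
    by (cases rule: WhileE) (use WhileTrue in blast)+
qed (auto elim: SkipE NAssignE RAssignE AAssignE)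

section \<open>The Active Set Algorithm as a program\<close>

definition for_less :: "vname \<Rightarrow> nexp \<Rightarrow> com \<Rightarrow> com" (\<open>(FOR _ < _/ DO _)\<close> [1000, 0, 61] 61) where
  "(FOR i < n DO c) =
     (i :=\<^sub>N NLit 0;; WHILE NLess (NVar i) n DO (c;; i :=\<^sub>N NPlus (NVar i) (NLit 1)))"

text \<open>
  The sets \<open>F\<^sub>k\<close> and \<open>B\<^sub>k\<close> are 0/1 arrays \<open>''F''\<close> and \<open>''B''\<close> that are updated in place; the real
  variables \<open>''n''\<close> and \<open>''n0''\<close> hold \<open>|F\<^sub>k|\<close> and \<open>|F\<^bsub>k-1\<^esub>|\<close>.  As \<open>J v\<close> has all entries equal to
  the sum of the entries of \<open>v\<close>, the product with \<open>Q_inv (card F)\<close> is evaluated with that sum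
  computed once, in \<open>''s''\<close>.
\<close>

definition active_set_prog :: com where
  "active_set_prog =
    (let d = NVar ''d''; i = NVar ''i'' in
     ''n'' :=\<^sub>R RLit 0;;
     FOR ''i'' < d DO (
       ''x''\<langle>i\<rangle> :=\<^sub>R RLit 0;;
       ''B''\<langle>i\<rangle> :=\<^sub>R RLit 0;;
       ''F''\<langle>i\<rangle> :=\<^sub>R RLit 1;;
       ''n'' :=\<^sub>R RPlus (RVar ''n'') (RLit 1));;
     ''n0'' :=\<^sub>R RLit 0;;
     ''k'' :=\<^sub>N NLit 1;;
     WHILE RNeq (RVar ''n0'') (RVar ''n'') DO (
       ''s'' :=\<^sub>R RLit 0;;
       FOR ''i'' < d DO (
         IF RNeq (RArr ''F'' i) (RLit 0)
         THEN ''s'' :=\<^sub>R RPlus (RVar ''s'') (RArr ''b'' i)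
         ELSE SKIP);;
       FOR ''i'' < d DO (
         IF RNeq (RArr ''F'' i) (RLit 0)
         THEN ''y''\<langle>i\<rangle> :=\<^sub>R RNeg (RTimes (RDiv (RLit 1) (RLit 2))
                (RMinus (RArr ''b'' i)
                  (RTimes (RDiv (RLit 1) (RPlus (RLit 1) (RVar ''n''))) (RVar ''s''))))
         ELSE SKIP);;
       ''n0'' :=\<^sub>R RVar ''n'';;
       FOR ''i'' < d DO (
         IF RNeq (RArr ''F'' i) (RLit 0)
         THEN (IF RLess (RLit 0) (RArr ''y'' i)
               THEN (''F''\<langle>i\<rangle> :=\<^sub>R RLit 0;;
                     ''B''\<langle>i\<rangle> :=\<^sub>R RLit 1;;
                     ''n'' :=\<^sub>R RMinus (RVar ''n'') (RLit 1))
               ELSE SKIP)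
         ELSE SKIP);;
       ''k'' :=\<^sub>N NPlus (NVar ''k'') (NLit 1));;
     FOR ''i'' < d DO (
       IF RNeq (RArr ''F'' i) (RLit 0)
       THEN ''x''\<langle>i\<rangle> :=\<^sub>R RArr ''y'' i
       ELSE SKIP))"

text \<open>Apart from the input, the initial memory contents are arbitrary.\<close>

definition holds_input :: "state \<Rightarrow> nat \<Rightarrow> real vec \<Rightarrow> bool" where
  "holds_input s d b \<longleftrightarrow> nat_var s ''d'' = d \<and> (\<forall>i<d. arr s ''b'' i = b $ i)"

definition output_of :: "state \<Rightarrow> nat \<Rightarrow> real vec" where
  "output_of s d = vec d (arr s ''x'')"

end

theory Submission
  imports Defs
begin

text \<open>
  By the formula for \<open>Q\<^sup>-\<^sup>1\<close>, a step keeps those \<open>i\<close> in \<open>F\<close> with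
  \<open>b i \<ge> threshold b F\<close>, the threshold being the sum of \<open>b\<close> over \<open>F\<close> divided by \<open>1 + |F|\<close>.
  Dropping entries below the threshold cannot lower it, so every dropped index remains below it,
  and this gives the sign condition on the multipliers once \<open>F\<close> is stable.  Each pass but the last
  drops an index, so there are at most \<open>d + 1\<close> passes, each of linear time.  The set-based
  algorithm and the program are not compared step by step: both end in an optimal solution, which
  is unique by strict convexity.
\<close>

section \<open>The optimality conditions\<close>

definition threshold :: "(nat \<Rightarrow> real) \<Rightarrow> nat set \<Rightarrow> real" where
  "threshold f F = sum f F / (1 + real (card F))"

text \<open>The entries of the unconstrained minimiser over vectors supported on \<open>F\<close>,
  written so that the sign is visible; \<open>stationary_eq\<close> recovers the expression given by
  \<open>Q_inv\<close>.\<close>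

definition stationary :: "(nat \<Rightarrow> real) \<Rightarrow> nat set \<Rightarrow> nat \<Rightarrow> real" where
  "stationary f F i = (threshold f F - f i) / 2"

definition shrink :: "(nat \<Rightarrow> real) \<Rightarrow> nat set \<Rightarrow> nat set" where
  "shrink f F = {i \<in> F. stationary f F i \<le> 0}"

text \<open>The multiplier half of the optimality conditions, vacuous for the initial set
  \<open>{..<d}\<close>. The feasibility half is the equation \<open>shrink f F = F\<close>, reached
  when the loop stops.\<close>

definition dominated :: "(nat \<Rightarrow> real) \<Rightarrow> nat \<Rightarrow> nat set \<Rightarrow> bool" where
  "dominated f d F \<longleftrightarrow> F \<subseteq> {..<d} \<and> (\<forall>i<d. i \<notin> F \<longrightarrow> f i \<le> threshold f F)"

definition candidate :: "nat \<Rightarrow> (nat \<Rightarrow> real) \<Rightarrow> nat set \<Rightarrow> real vec" where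
  "candidate d f F = vec d (\<lambda>i. if i \<in> F then stationary f F i else 0)"

lemma shrink_subset: "shrink f F \<subseteq> F"
  by (auto simp: shrink_def)

lemma sum_eq_threshold: "sum f F = (1 + real (card F)) * threshold f F"
  by (simp add: threshold_def add_nonneg_eq_0_iff)

lemma stationary_eq:
  "stationary f F i = - (1 / 2 * (f i - 1 / (1 + real (card F)) * sum f F))"
  by (simp add: stationary_def threshold_def diff_divide_distrib)

lemma sum_stationary: "sum (stationary f F) F = - (threshold f F / 2)"
proof -
  have "sum (stationary f F) F = (real (card F) * threshold f F - sum f F) / 2"
    by (simp add: stationary_def sum_subtractf flip: sum_divide_distrib)
  then show ?thesis
    by (simp add: sum_eq_threshold algebra_simps)
qed

text \<open>\<open>threshold f F\<close> is the mean of the values of \<open>f\<close> on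
  \<open>F\<close> together with one extra value 0, hence the 1 in the denominator. Removing values
  below a mean cannot lower the mean of the rest, and the extra 0 is never removed.\<close>

lemma threshold_shrink:
  assumes "finite F"
  shows "threshold f F \<le> threshold f (shrink f F)"
proof -
  define R where "R = F - shrink f F"
  have F: "F = shrink f F \<union> R" "shrink f F \<inter> R = {}" "finite R" "finite (shrink f F)"
    using assms shrink_subset[of f F] finite_subset by (auto simp: R_def)
  have "sum f R \<le> real (card R) * threshold f F"
    by (rule sum_bounded_above) (auto simp: R_def shrink_def stationary_def)
  moreover have "sum f F = sum f (shrink f F) + sum f R"
    using F by (metis sum.union_disjoint)
  moreover have "real (card F) = real (card (shrink f F)) + real (card R)"
    using F by (metis card_Un_disjoint of_nat_add)
  ultimately have "threshold f F * (1 + real (card (shrink f F))) \<le> sum f (shrink f F)"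
    using sum_eq_threshold[of f F] by (simp add: algebra_simps)
  then show ?thesis
    unfolding threshold_def[of f "shrink f F"] by (simp add: pos_le_divide_eq)
qed

text \<open>An index outside the new set either was outside \<open>F\<close> already or has just
  been dropped. Both ways its value is at most the old threshold, and
  \<open>threshold_shrink\<close> applies.\<close>

lemma dominated_shrink:
  assumes "dominated f d F"
  shows "dominated f d (shrink f F)"
  unfolding dominated_def
proof (intro conjI allI impI)
  show "shrink f F \<subseteq> {..<d}"
    using assms shrink_subset[of f F] by (auto simp: dominated_def)
  fix i assume i: "i < d" "i \<notin> shrink f F"
  have "finite F"
    using assms finite_subset by (auto simp: dominated_def)
  then have "threshold f F \<le> threshold f (shrink f F)"
    by (rule threshold_shrink)
  moreover have "f i \<le> threshold f F"
    using i assms by (cases "i \<in> F") (auto simp: dominated_def shrink_def stationary_def)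
  ultimately show "f i \<le> threshold f (shrink f F)"
    by simp
qed

text \<open>\<open>J_mat\<close> enters the quadratic form only through the square of the coordinate
  sum, so the optimality argument can work with scalar sums.\<close>

lemma objective_eq:
  assumes "x \<in> carrier_vec d" "b \<in> carrier_vec d"
  shows "objective d b x =
    (\<Sum>i<d. (x $ i)\<^sup>2) + (\<Sum>i<d. x $ i)\<^sup>2 + (\<Sum>i<d. b $ i * x $ i)"
proof -
  have Qx: "(Q_mat d *\<^sub>v x) $ i = 2 * x $ i + 2 * (\<Sum>j<d. x $ j)" if "i < d" for i
  proof -
    have "(Q_mat d *\<^sub>v x) $ i = (\<Sum>j<d. 2 * ((if i = j then x $ j else 0) + x $ j))"
      using that assms
      by (auto simp: Q_mat_def J_mat_def scalar_prod_def lessThan_atLeast0 intro!: sum.cong)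
    also have "\<dots> = 2 * x $ i + 2 * (\<Sum>j<d. x $ j)"
      using that by (simp add: sum.distrib flip: sum_distrib_left)
    finally show ?thesis .
  qed
  have "x \<bullet> (Q_mat d *\<^sub>v x) = (\<Sum>i<d. x $ i * (2 * x $ i + 2 * (\<Sum>j<d. x $ j)))"
    using assms Qx
    by (simp add: scalar_prod_def Q_mat_def J_mat_def lessThan_atLeast0)
  also have "\<dots> = 2 * (\<Sum>i<d. (x $ i)\<^sup>2) + 2 * (\<Sum>i<d. x $ i)\<^sup>2"
    by (simp add: power2_eq_square distrib_left sum.distrib sum_distrib_left sum_distrib_right
        mult_ac)
  finally show ?thesis
    using assms by (simp add: objective_def scalar_prod_def lessThan_atLeast0)
qed

text \<open>
  At the candidate \<open>x\<close> the gradient has the entries \<open>g i = 2 * x $ i - threshold f F + f i\<close>, because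
  the entries of \<open>x\<close> sum to \<open>- threshold f F / 2\<close>.  So \<open>g\<close> vanishes on \<open>F\<close> and is nonpositive
  elsewhere; these are the Karush-Kuhn-Tucker conditions.
\<close>

lemma candidate_growth:
  assumes dom: "dominated (($) b) d F" and b: "b \<in> carrier_vec d"
    and z: "z \<in> carrier_vec d" "z \<le> 0\<^sub>v d"
  defines "x \<equiv> candidate d (($) b) F"
  shows "objective d b x + (\<Sum>i<d. (z $ i - x $ i)\<^sup>2) \<le> objective d b z"
proof -
  define \<tau> where "\<tau> = threshold (($) b) F"
  define g where "g i = 2 * x $ i - \<tau> + b $ i" for i
  have x: "x \<in> carrier_vec d"
    by (simp add: x_def candidate_def)
  have F: "F \<subseteq> {..<d}"
    using dom by (simp add: dominated_def)
  have "(\<Sum>i<d. x $ i) = (\<Sum>i<d. if i \<in> F then stationary (($) b) F i else 0)"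
    by (simp add: x_def candidate_def)
  also have "\<dots> = sum (stationary (($) b) F) ({..<d} \<inter> F)"
    by (simp add: sum.inter_restrict)
  also have "\<dots> = - (\<tau> / 2)"
    using F by (simp add: sum_stationary \<tau>_def inf.absorb2)
  finally have sum_x: "(\<Sum>i<d. x $ i) = - (\<tau> / 2)" .
  have "0 \<le> g i * (z $ i - x $ i)" if "i < d" for i
  proof (cases "i \<in> F")
    case True
    then have "g i = 0"
      using that by (simp add: g_def x_def candidate_def stationary_def \<tau>_def field_simps)
    then show ?thesis
      by simp
  next
    case False
    then have "g i \<le> 0" "x $ i = 0"
      using that dom by (auto simp: g_def x_def candidate_def dominated_def \<tau>_def)
    moreover have "z $ i \<le> 0"
      using z that by (auto simp: less_eq_vec_def)
    ultimately show ?thesis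
      by (simp add: mult_nonpos_nonpos)
  qed
  then have g: "0 \<le> (\<Sum>i<d. g i * (z $ i - x $ i))"
    by (intro sum_nonneg) auto
  have "objective d b z - objective d b x - (\<Sum>i<d. (z $ i - x $ i)\<^sup>2)
      = (\<Sum>i<d. (z $ i)\<^sup>2 - (x $ i)\<^sup>2 + b $ i * (z $ i - x $ i) - (z $ i - x $ i)\<^sup>2)
        + ((\<Sum>i<d. z $ i)\<^sup>2 - (\<Sum>i<d. x $ i)\<^sup>2)"
    using x b z by (simp add: objective_eq sum.distrib sum_subtractf right_diff_distrib)
  \<comment> \<open>Entrywise, \<open>z^2 - x^2 - (z - x)^2 = 2 * x * (z - x)\<close>; together with
    \<open>b\<close> this is \<open>g\<close> shifted by \<open>\<tau>\<close>.\<close>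
  also have "(\<Sum>i<d. (z $ i)\<^sup>2 - (x $ i)\<^sup>2 + b $ i * (z $ i - x $ i) - (z $ i - x $ i)\<^sup>2)
      = (\<Sum>i<d. g i * (z $ i - x $ i) + \<tau> * (z $ i - x $ i))"
    by (intro sum.cong) (auto simp: g_def power2_eq_square algebra_simps)
  also have "\<dots> = (\<Sum>i<d. g i * (z $ i - x $ i)) + \<tau> * ((\<Sum>i<d. z $ i) - (\<Sum>i<d. x $ i))"
    by (simp add: sum.distrib sum_subtractf flip: sum_distrib_left)
  \<comment> \<open>By \<open>sum_x\<close>, \<open>\<tau>\<close> is minus twice the sum of the
    \<open>x $ i\<close>, so the linear term turns the difference of squares into a perfect
    square.\<close>
  also have "\<dots> + ((\<Sum>i<d. z $ i)\<^sup>2 - (\<Sum>i<d. x $ i)\<^sup>2)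
      = (\<Sum>i<d. g i * (z $ i - x $ i)) + ((\<Sum>i<d. z $ i) - (\<Sum>i<d. x $ i))\<^sup>2"
    unfolding sum_x by (simp add: power2_eq_square algebra_simps)
  finally show ?thesis
    using g by (smt (verit) zero_le_power2)
qed

text \<open>Being a fixed point of \<open>shrink\<close> supplies feasibility; optimality is the
  growth bound with the squared distance discarded.\<close>

lemma candidate_optimal:
  assumes dom: "dominated (($) b) d F" and fp: "shrink (($) b) F = F" and b: "b \<in> carrier_vec d"
  shows "optimal_solution d b (candidate d (($) b) F)"
  unfolding optimal_solution_def
proof (intro conjI ballI impI)
  show "candidate d (($) b) F \<in> carrier_vec d"
    by (simp add: candidate_def)
  show "candidate d (($) b) F \<le> 0\<^sub>v d"
    using fp by (auto simp: candidate_def less_eq_vec_def shrink_def)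
  fix z :: "real vec" assume "z \<in> carrier_vec d" "z \<le> 0\<^sub>v d"
  then show "objective d b (candidate d (($) b) F) \<le> objective d b z"
    using candidate_growth[OF dom b, of z]
      sum_nonneg[of "{..<d}" "\<lambda>i. (z $ i - candidate d (($) b) F $ i)\<^sup>2"]
    by simp
qed

text \<open>The growth bound at an equally good point forces the squared distance to vanish. As
  \<open>F\<close> is arbitrary, this also identifies candidates that come from different stable
  sets.\<close>

lemma optimal_unique:
  assumes dom: "dominated (($) b) d F" and fp: "shrink (($) b) F = F" and b: "b \<in> carrier_vec d"
    and z: "optimal_solution d b z"
  shows "z = candidate d (($) b) F"
proof -
  let ?x = "candidate d (($) b) F"
  have z': "z \<in> carrier_vec d" "z \<le> 0\<^sub>v d"
    using z by (auto simp: optimal_solution_def)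
  have "objective d b z \<le> objective d b ?x"
    using z candidate_optimal[OF dom fp b] by (auto simp: optimal_solution_def)
  then have "(\<Sum>i<d. (z $ i - ?x $ i)\<^sup>2) \<le> 0"
    using candidate_growth[OF dom b z'] by simp
  then have "(\<Sum>i<d. (z $ i - ?x $ i)\<^sup>2) = 0"
    by (intro order.antisym sum_nonneg) auto
  then have "\<forall>i<d. z $ i = ?x $ i"
    by (subst (asm) sum_nonneg_eq_0_iff) auto
  then show ?thesis
    using z' by (auto simp: candidate_def)
qed

section \<open>The algorithm on sets and vectors\<close>

lemma bij_betw_pick:
  assumes "finite F"
  shows "bij_betw (pick F) {..<card F} F"
proof (rule bij_betw_byWitness[where f' = "\<lambda>i. card {j \<in> F. j < i}"])
  show "(\<lambda>i. card {j \<in> F. j < i}) ` F \<subseteq> {..<card F}"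
    using assms by (auto intro!: psubset_card_mono)
qed (auto simp: card_pick pick_card_in_set pick_in_set)

text \<open>Here positional storage disappears: the identity part picks out \<open>b $ i\<close>,
  and the all-ones part gives a sum over positions that \<open>bij_betw_pick\<close> turns into a
  sum over \<open>F\<close>.\<close>

lemma entry_at_stationary:
  assumes F: "finite F" and i: "i \<in> F"
  shows "entry_at F (- (Q_inv (card F) *\<^sub>v sub_vec b F)) i = stationary (($) b) F i"
proof -
  define p where "p = card {j \<in> F. j < i}"
  have p: "p < card F" "pick F p = i"
    using F i by (auto simp: p_def pick_card_in_set intro!: psubset_card_mono)
  let ?c = "1 / (1 + real (card F))"
  have "(Q_inv (card F) *\<^sub>v sub_vec b F) $ p
      = (\<Sum>j<card F. 1/2 * ((if p = j then b $ pick F j else 0) - ?c * b $ pick F j))"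
    using p by (auto simp: Q_inv_def J_mat_def sub_vec_def scalar_prod_def lessThan_atLeast0
        left_diff_distrib intro!: sum.cong)
  also have "\<dots> = 1/2 * (b $ i - ?c * (\<Sum>j<card F. b $ pick F j))"
    using p by (simp add: sum_subtractf flip: sum_distrib_left sum_divide_distrib)
  also have "(\<Sum>j<card F. b $ pick F j) = sum (($) b) F"
    by (rule sum.reindex_bij_betw[OF bij_betw_pick[OF F]])
  finally have "(Q_inv (card F) *\<^sub>v sub_vec b F) $ p = 1/2 * (b $ i - ?c * sum (($) b) F)" .
  moreover have "entry_at F (- (Q_inv (card F) *\<^sub>v sub_vec b F)) i
      = - ((Q_inv (card F) *\<^sub>v sub_vec b F) $ p)"
    using p unfolding entry_at_def p_def[symmetric]
    by (intro index_uminus_vec) (simp add: Q_inv_def J_mat_def)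
  ultimately show ?thesis
    by (simp add: stationary_eq)
qed

lemma active_set_eq_candidate:
  assumes "d \<ge> 1"
  obtains F where "dominated (($) b) d F" "shrink (($) b) F = F"
    "active_set d b = Some (candidate d (($) b) F)"
proof -
  let ?f = "($) b"
  let ?y = "\<lambda>F. - (Q_inv (card F) *\<^sub>v sub_vec b F)"
  let ?G = "\<lambda>(F', F, B, y :: real vec). card F' \<noteq> card F"
  let ?S = "\<lambda>(F', F, B, y :: real vec). let y' = ?y F; P = {i \<in> F. entry_at F y' i > 0}
                in (F, F - P, B \<union> P, y')"
  let ?s = "({}, {..<d}, {}, vNil)"
  \<comment> \<open>The first disjunct is the state before any pass, when \<open>y\<close> is still
    a dummy; the second describes every later state.\<close>
  let ?I = "\<lambda>(F', F, B :: nat set, y :: real vec). dominated ?f d F \<and>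
     (F' = {} \<and> F = {..<d} \<or> finite F' \<and> F = shrink ?f F' \<and> y = ?y F')"
  \<comment> \<open>The extra 1 pays for the final pass, which leaves \<open>F\<close> unchanged and
    so does not decrease \<open>card F\<close>.\<close>
  let ?m = "\<lambda>(F', F, B :: nat set, y :: real vec). card F + (if F = F' then 0 else 1)"
  have step: "?S (F', F, B, y) = (F, shrink ?f F, B \<union> (F - shrink ?f F), ?y F)"
    if "finite F" for F' F B y
    using that by (auto simp: Let_def shrink_def entry_at_stationary not_le)
  have pres: "?I (?S s) \<and> ?m (?S s) < ?m s" if "?I s" "?G s" for s
  proof -
    obtain F' F B y where s: "s = (F', F, B, y)"
      by (cases s) auto
    have dom: "dominated ?f d F" and "F' \<noteq> F"
      using that unfolding s by blast+
    moreover have "finite F"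
      using dom finite_subset[of F "{..<d}"] by (auto simp: dominated_def)
    ultimately have F: "finite F" "dominated ?f d F" "F' \<noteq> F"
      by blast+
    have "card (shrink ?f F) < card F" if "shrink ?f F \<noteq> F"
      using that F shrink_subset by (intro psubset_card_mono) auto
    then show ?thesis
      unfolding s step[OF F(1)] using F dominated_shrink by auto
  qed
  have init: "?I ?s"
    by (simp add: dominated_def)
  obtain s where s: "while_option ?G ?S ?s = Some s"
    using measure_while_option_Some[of ?I ?G ?S ?m ?s, OF pres init] by blast
  have "\<not> ?G s"
    by (rule while_option_stop[OF s])
  moreover have "?I s"
    by (rule while_option_rule[where P = ?I, OF conjunct1[OF pres] s init])
  moreover obtain F' F B y where sF: "s = (F', F, B, y)"
    by (cases s) auto
  ultimately have F: "dominated ?f d F" "card F' = card F"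
    "F' = {} \<and> F = {..<d} \<or> finite F' \<and> F = shrink ?f F' \<and> y = ?y F'"
    by auto
  \<comment> \<open>As \<open>d >= 1\<close>, the initial state passes the loop test, so at exit
    \<open>y\<close> has really been computed.\<close>
  have "\<not> (F' = {} \<and> F = {..<d})"
    using F(2) assms by auto
  then have F': "finite F'" "F = shrink ?f F'" "y = ?y F'"
    using F(3) by blast+
  \<comment> \<open>The loop compares only cardinalities, but the sets are nested, so equal size
    means equal sets.\<close>
  have "F' = F"
    using F(2) F'(2) card_subset_eq[OF F'(1) shrink_subset[of ?f F']] by metis
  then have "finite F" "shrink ?f F = F" "y = ?y F"
    using F' by metis+
  moreover have "vec d (\<lambda>i. if i \<in> F then entry_at F y i else 0) = candidate d ?f F"
    unfolding candidate_def \<open>y = ?y F\<close> using entry_at_stationary[OF \<open>finite F\<close>]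
    by (intro eq_vecI) auto
  moreover have "active_set d b = Some (vec d (\<lambda>i. if i \<in> F then entry_at F y i else 0))"
    unfolding active_set_def s sF by simp
  ultimately show ?thesis
    using that[OF F(1) \<open>shrink ?f F = F\<close>] by metis
qed

section \<open>Reasoning about programs and their running time\<close>

text \<open>Total correctness: termination is part of the claim. The postcondition also receives the
  time, so costs accumulate through \<open>wp_Seq\<close>.\<close>

definition wp :: "com \<Rightarrow> (nat \<Rightarrow> state \<Rightarrow> bool) \<Rightarrow> state \<Rightarrow> bool" where
  "wp c Q s \<longleftrightarrow> (\<exists>t s'. (c, s) \<Rightarrow> t \<Down> s' \<and> Q t s')"

lemma wp_simps [simp]:
  "wp SKIP Q s = Q 0 s"
  "wp (x :=\<^sub>N e) Q s = Q (ncost e + 1) (s\<lparr>nat_var := (nat_var s)(x := nval e s)\<rparr>)"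
  "wp (x :=\<^sub>R r) Q s = Q (rcost r + 1) (s\<lparr>real_var := (real_var s)(x := rval r s)\<rparr>)"
  "wp (a\<langle>e\<rangle> :=\<^sub>R r) Q s =
     Q (ncost e + rcost r + 1) (s\<lparr>arr := (arr s)(a := (arr s a)(nval e s := rval r s))\<rparr>)"
  unfolding wp_def by (metis exec.Skip exec.NAssign exec.RAssign exec.AAssign exec_deterministic)+

lemma wp_Seq [simp]: "wp (c1;; c2) Q s = wp c1 (\<lambda>t. wp c2 (\<lambda>u. Q (t + u))) s"
  unfolding wp_def by (blast intro: exec.Seq elim: SeqE)

lemma wp_Cond [simp]:
  "wp (IF p THEN c1 ELSE c2) Q s =
     (if bval p s then wp c1 (\<lambda>t. Q (bcost p + t)) s else wp c2 (\<lambda>t. Q (bcost p + t)) s)"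
  unfolding wp_def by (auto intro: exec.intros elim!: CondE)

lemma wp_mono: "wp c Q s \<Longrightarrow> (\<And>t s'. Q t s' \<Longrightarrow> R t s') \<Longrightarrow> wp c R s"
  unfolding wp_def by blast

text \<open>The index of the invariant is both the termination variant and a bound on the remaining
  passes. Each pass pays for its guard and at most \<open>K\<close> for the body; the last summand
  is the failing guard.\<close>

lemma wp_While:
  assumes body: "\<And>n s. I n s \<Longrightarrow> bval p s \<Longrightarrow> wp c (\<lambda>t s'. t \<le> K \<and> (\<exists>n'<n. I n' s')) s"
    and "I n s"
  shows "wp (WHILE p DO c)
    (\<lambda>t s'. t \<le> n * (bcost p + K) + bcost p \<and> (\<exists>n'. I n' s') \<and> \<not> bval p s') s"
  using \<open>I n s\<close>
proof (induction n arbitrary: s rule: less_induct)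
  case (less n)
  show ?case
  proof (cases "bval p s")
    case False
    then have "(WHILE p DO c, s) \<Rightarrow> bcost p \<Down> s"
      by (rule exec.WhileFalse)
    then show ?thesis
      unfolding wp_def using less.prems False by (intro exI[of _ "bcost p"] exI[of _ s]) auto
  next
    case True
    obtain t s1 n' where 1: "(c, s) \<Rightarrow> t \<Down> s1" "t \<le> K" "n' < n" "I n' s1"
      using body[OF less.prems True] by (auto simp: wp_def)
    obtain u s2 where 2: "(WHILE p DO c, s1) \<Rightarrow> u \<Down> s2" "u \<le> n' * (bcost p + K) + bcost p"
      "\<exists>n'. I n' s2" "\<not> bval p s2"
      using less.IH[OF 1(3,4)] by (auto simp: wp_def)
    \<comment> \<open>The variant may drop by more than one, so the current pass and the
      \<open>n'\<close> remaining ones fit into the budget for \<open>n\<close>.\<close>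
    have "Suc n' * (bcost p + K) \<le> n * (bcost p + K)"
      using 1(3) by (intro mult_le_mono1) simp
    then have "bcost p + t + u \<le> n * (bcost p + K) + bcost p"
      using 1(2) 2(2) by simp
    then show ?thesis
      unfolding wp_def using exec.WhileTrue[OF True 1(1) 2(1)] 2(3,4) by blast
  qed
qed

text \<open>The 3 per iteration is one guard plus the two units of the increment; the final 2 is the
  initialisation of the counter and the failing guard.\<close>

lemma wp_For:
  assumes body: "\<And>k s. k < d \<Longrightarrow> I k s \<Longrightarrow> nat_var s i = k \<Longrightarrow>
      wp c (\<lambda>t s'. t \<le> K \<and> nat_var s' i = k \<and> I (Suc k) (s'\<lparr>nat_var := (nat_var s')(i := Suc k)\<rparr>)) s"
    and bound: "\<And>k s. I k s \<Longrightarrow> nat_var s v = d"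
    and init: "I 0 (s\<lparr>nat_var := (nat_var s)(i := 0)\<rparr>)"
  shows "wp (FOR i < NVar v DO c) (\<lambda>t s'. t \<le> d * (K + 3) + 2 \<and> I d s') s"
proof -
  let ?J = "\<lambda>n s. nat_var s i \<le> d \<and> n = d - nat_var s i \<and> I (nat_var s i) s"
  have "wp (WHILE NLess (NVar i) (NVar v) DO (c;; i :=\<^sub>N NPlus (NVar i) (NLit 1)))
    (\<lambda>t s'. t \<le> d * (bcost (NLess (NVar i) (NVar v)) + (K + 2)) + bcost (NLess (NVar i) (NVar v))
      \<and> (\<exists>n. ?J n s') \<and> \<not> bval (NLess (NVar i) (NVar v)) s')
    (s\<lparr>nat_var := (nat_var s)(i := 0)\<rparr>)"
  proof (rule wp_While[where I = ?J])
    fix n s assume J: "?J n s" and "bval (NLess (NVar i) (NVar v)) s"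
    then have less: "nat_var s i < d"
      using bound[of "nat_var s i" s] by simp
    have "wp c (\<lambda>t s'. t \<le> K \<and> nat_var s' i = nat_var s i \<and>
        I (Suc (nat_var s i)) (s'\<lparr>nat_var := (nat_var s')(i := Suc (nat_var s i))\<rparr>)) s"
      using body[OF less _ refl] J by simp
    then show "wp (c;; i :=\<^sub>N NPlus (NVar i) (NLit 1)) (\<lambda>t s'. t \<le> K + 2 \<and> (\<exists>n'<n. ?J n' s')) s"
      unfolding wp_Seq by (rule wp_mono) (use J less in auto)
  qed (use init in simp)
  then show ?thesis
    unfolding for_less_def wp_Seq wp_simps nval.simps ncost.simps
  proof (rule wp_mono, elim conjE exE, intro conjI)
    fix t s'
    assume "nat_var s' i \<le> d" "I (nat_var s' i) s'" "\<not> bval (NLess (NVar i) (NVar v)) s'"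
    then have "nat_var s' i = d"
      using bound[of "nat_var s' i" s'] by simp
    then show "I d s'"
      using \<open>I (nat_var s' i) s'\<close> by simp
  qed (simp add: algebra_simps)
qed

section \<open>The program\<close>

text \<open>The output array \<open>''x''\<close> is zero throughout the main loop.\<close>

definition represents :: "nat \<Rightarrow> (nat \<Rightarrow> real) \<Rightarrow> nat set \<Rightarrow> state \<Rightarrow> bool" where
  "represents d f F s \<longleftrightarrow> F \<subseteq> {..<d} \<and> nat_var s ''d'' = d \<and>
     (\<forall>i<d. arr s ''b'' i = f i \<and> arr s ''F'' i = of_bool (i \<in> F) \<and> arr s ''x'' i = 0) \<and>
     real_var s ''n'' = real (card F)"

definition "prog_init =
  (''n'' :=\<^sub>R RLit 0;;
   FOR ''i'' < NVar ''d'' DO (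
     ''x''\<langle>NVar ''i''\<rangle> :=\<^sub>R RLit 0;;
     ''B''\<langle>NVar ''i''\<rangle> :=\<^sub>R RLit 0;;
     ''F''\<langle>NVar ''i''\<rangle> :=\<^sub>R RLit 1;;
     ''n'' :=\<^sub>R RPlus (RVar ''n'') (RLit 1));;
   ''n0'' :=\<^sub>R RLit 0;;
   ''k'' :=\<^sub>N NLit 1)"

definition "prog_sum =
  (FOR ''i'' < NVar ''d'' DO (
     IF RNeq (RArr ''F'' (NVar ''i'')) (RLit 0)
     THEN ''s'' :=\<^sub>R RPlus (RVar ''s'') (RArr ''b'' (NVar ''i''))
     ELSE SKIP))"

definition "prog_solve =
  (FOR ''i'' < NVar ''d'' DO (
     IF RNeq (RArr ''F'' (NVar ''i'')) (RLit 0)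
     THEN ''y''\<langle>NVar ''i''\<rangle> :=\<^sub>R RNeg (RTimes (RDiv (RLit 1) (RLit 2))
            (RMinus (RArr ''b'' (NVar ''i''))
              (RTimes (RDiv (RLit 1) (RPlus (RLit 1) (RVar ''n''))) (RVar ''s''))))
     ELSE SKIP))"

definition "prog_shrink =
  (FOR ''i'' < NVar ''d'' DO (
     IF RNeq (RArr ''F'' (NVar ''i'')) (RLit 0)
     THEN (IF RLess (RLit 0) (RArr ''y'' (NVar ''i''))
           THEN (''F''\<langle>NVar ''i''\<rangle> :=\<^sub>R RLit 0;;
                 ''B''\<langle>NVar ''i''\<rangle> :=\<^sub>R RLit 1;;
                 ''n'' :=\<^sub>R RMinus (RVar ''n'') (RLit 1))
           ELSE SKIP)
     ELSE SKIP))"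

definition "prog_step =
  (''s'' :=\<^sub>R RLit 0;; prog_sum;; prog_solve;; ''n0'' :=\<^sub>R RVar ''n'';; prog_shrink;;
   ''k'' :=\<^sub>N NPlus (NVar ''k'') (NLit 1))"

definition "prog_output =
  (FOR ''i'' < NVar ''d'' DO (
     IF RNeq (RArr ''F'' (NVar ''i'')) (RLit 0)
     THEN ''x''\<langle>NVar ''i''\<rangle> :=\<^sub>R RArr ''y'' (NVar ''i'')
     ELSE SKIP))"

text \<open>Unfolding suffices because \<open>;;\<close> associates to the left: the first four
  commands already form one subterm, namely \<open>prog_init\<close>.\<close>

lemma active_set_prog_eq:
  "active_set_prog = prog_init;; WHILE RNeq (RVar ''n0'') (RVar ''n'') DO prog_step;; prog_output"
  unfolding active_set_prog_def prog_init_def prog_step_def prog_output_def prog_sum_def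
    prog_solve_def prog_shrink_def Let_def ..

lemma wp_prog_init:
  assumes "nat_var s ''d'' = d" "\<forall>i<d. arr s ''b'' i = f i"
  shows "wp prog_init (\<lambda>t s'. t \<le> 8 * d + 5 \<and> represents d f {..<d} s' \<and> real_var s' ''n0'' = 0) s"
proof -
  let ?I = "\<lambda>k s. nat_var s ''d'' = d \<and> real_var s ''n'' = real k \<and> (\<forall>i<d. arr s ''b'' i = f i) \<and>
    (\<forall>i<k. arr s ''F'' i = 1 \<and> arr s ''x'' i = 0)"
  show ?thesis
    unfolding prog_init_def wp_Seq wp_simps
    \<comment> \<open>\<open>K = 5\<close> counts four assignments and one addition.\<close>
    by (rule wp_mono[OF wp_For[where I = ?I and d = d and K = 5]])
      (use assms in \<open>auto simp: represents_def less_Suc_eq\<close>)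
qed

lemma wp_prog_sum:
  assumes "represents d f F s" "real_var s ''s'' = 0"
  shows "wp prog_sum (\<lambda>t s'. t \<le> 6 * d + 2 \<and> represents d f F s' \<and> real_var s' ''s'' = sum f F) s"
proof -
  let ?I = "\<lambda>k s. represents d f F s \<and> real_var s ''s'' = sum f (F \<inter> {..<k})"
  have *: "F \<inter> {..<Suc k} = (if k \<in> F then insert k (F \<inter> {..<k}) else F \<inter> {..<k})" for k
    by (auto simp: less_Suc_eq)
  have "F \<inter> {..<d} = F"
    using assms by (auto simp: represents_def)
  then show ?thesis
    unfolding prog_sum_def
    by (intro wp_mono[OF wp_For[where I = ?I and d = d and K = 3]])
      (use assms in \<open>auto simp: represents_def *\<close>)
qed

lemma wp_prog_solve:
  assumes "represents d f F s" "real_var s ''s'' = sum f F"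
  shows "wp prog_solve (\<lambda>t s'. t \<le> 12 * d + 2 \<and> represents d f F s' \<and>
    (\<forall>i\<in>F. arr s' ''y'' i = stationary f F i)) s"
proof -
  let ?I = "\<lambda>k s. represents d f F s \<and> real_var s ''s'' = sum f F \<and>
    (\<forall>i\<in>F. i < k \<longrightarrow> arr s ''y'' i = stationary f F i)"
  show ?thesis
    unfolding prog_solve_def
    \<comment> \<open>\<open>K = 9\<close> counts the membership test, seven arithmetic operations
      and the store.\<close>
    by (intro wp_mono[OF wp_For[where I = ?I and d = d and K = 9]])
      (use assms in \<open>auto simp: represents_def less_Suc_eq stationary_eq\<close>)
qed

lemma wp_prog_shrink:
  assumes "represents d f F s" "\<forall>i\<in>F. arr s ''y'' i = stationary f F i"
    "real_var s ''n0'' = real (card F)"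
  shows "wp prog_shrink (\<lambda>t s'. t \<le> 9 * d + 2 \<and> represents d f (shrink f F) s' \<and>
    (\<forall>i\<in>F. arr s' ''y'' i = stationary f F i) \<and> real_var s' ''n0'' = real (card F)) s"
proof -
  \<comment> \<open>The active set after the first \<open>k\<close> indices have been examined.
    Updating in place is harmless, since the tests read \<open>y\<close>, which was computed from
    the whole of \<open>F\<close>.\<close>
  define P where "P k = F - {i. i < k \<and> stationary f F i > 0}" for k
  let ?I = "\<lambda>k s. represents d f (P k) s \<and>
    (\<forall>i\<in>F. arr s ''y'' i = stationary f F i) \<and> real_var s ''n0'' = real (card F)"
  have "P 0 = F" "P d = shrink f F"
    using assms by (auto simp: P_def shrink_def represents_def not_less)
  have F: "F \<subseteq> {..<d}" "finite F"
    using assms finite_subset by (auto simp: represents_def)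
  \<comment> \<open>Index \<open>k\<close> is still untouched when its turn comes. Positivity of the
    cardinality makes the real subtraction on \<open>''n''\<close> agree with
    \<open>card\<close>.\<close>
  have P: "P (Suc k) = (if k \<in> F \<and> stationary f F k > 0 then P k - {k} else P k)"
    "k \<in> P k \<longleftrightarrow> k \<in> F" "finite (P k)" "k \<in> F \<Longrightarrow> card (P k) > 0" for k
    using F by (auto simp: P_def less_Suc_eq card_gt_0_iff)
  show ?thesis
    unfolding prog_shrink_def
    by (intro wp_mono[OF wp_For[where I = ?I and d = d and K = 6]])
      (use assms \<open>P 0 = F\<close> \<open>P d = shrink f F\<close> in
        \<open>auto simp: represents_def P card_Diff_singleton of_nat_diff Suc_leI\<close>)
qed

text \<open>The three loops take \<open>27 * d + 6\<close>; two plain assignments and the increment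
  of \<open>''k''\<close>, worth two units, add 4.\<close>

lemma wp_prog_step:
  assumes "represents d f F s"
  shows "wp prog_step (\<lambda>t s'. t \<le> 27 * d + 10 \<and> represents d f (shrink f F) s' \<and>
    (\<forall>i\<in>F. arr s' ''y'' i = stationary f F i) \<and> real_var s' ''n0'' = real (card F)) s"
  unfolding prog_step_def wp_Seq wp_simps
proof (rule wp_mono[OF wp_prog_sum[where d = d and f = f and F = F]], goal_cases)
  case (3 t s1)
  then show ?case
  proof (elim conjE, intro wp_mono[OF wp_prog_solve[where d = d and f = f and F = F]], goal_cases)
    case (3 u s2)
    then show ?case
      by (intro wp_mono[OF wp_prog_shrink[where d = d and f = f and F = F]])
        (auto simp: represents_def)
  qed
qed (use assms in \<open>auto simp: represents_def\<close>)

text \<open>Only entries in \<open>F\<close> are written; \<open>represents\<close> already makes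
  the others zero.\<close>

lemma wp_prog_output:
  assumes "represents d f F s" "\<forall>i\<in>F. arr s ''y'' i = stationary f F i"
  shows "wp prog_output (\<lambda>t s'. t \<le> 5 * d + 2 \<and> output_of s' d = candidate d f F) s"
proof -
  let ?I = "\<lambda>k s. nat_var s ''d'' = d \<and> (\<forall>i<d. arr s ''F'' i = of_bool (i \<in> F)) \<and>
    (\<forall>i\<in>F. arr s ''y'' i = stationary f F i) \<and>
    (\<forall>i<d. arr s ''x'' i = (if i \<in> F \<and> i < k then stationary f F i else 0))"
  show ?thesis
    unfolding prog_output_def
    by (intro wp_mono[OF wp_For[where I = ?I and d = d and K = 2]])
      (use assms in \<open>auto simp: represents_def less_Suc_eq output_of_def candidate_def\<close>)
qed

lemma wp_prog_loop:
  assumes "represents d f {..<d} s" "real_var s ''n0'' = 0" "d \<ge> 1"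
  shows "wp (WHILE RNeq (RVar ''n0'') (RVar ''n'') DO prog_step)
    (\<lambda>t s'. t \<le> (d + 1) * (27 * d + 11) + 1 \<and>
      (\<exists>F. dominated f d F \<and> shrink f F = F \<and> represents d f F s' \<and>
        (\<forall>i\<in>F. arr s' ''y'' i = stationary f F i))) s"
proof -
  \<comment> \<open>The same invariant and variant as for the set-based loop. Memory keeps only the
    size of the previous set, in \<open>''n0''\<close>, so \<open>F'\<close> is quantified
    existentially.\<close>
  let ?I = "\<lambda>n s. \<exists>F' F. represents d f F s \<and> dominated f d F \<and> real_var s ''n0'' = real (card F') \<and>
    n = card F + (if F = F' then 0 else 1) \<and>
    (F' = {} \<and> F = {..<d} \<or>
     finite F' \<and> F = shrink f F' \<and> (\<forall>i\<in>F'. arr s ''y'' i = stationary f F' i))"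
  let ?p = "RNeq (RVar ''n0'') (RVar ''n'')"
  have "?I (d + 1) s"
    \<comment> \<open>The empty previous set matches \<open>''n0'' = 0\<close>; it differs from
      \<open>{..<d}\<close> as \<open>d >= 1\<close>, so the variant starts at
      \<open>d + 1\<close>.\<close>
    by (rule exI[of _ "{}"], rule exI[of _ "{..<d}"]) (use assms in \<open>auto simp: dominated_def lessThan_empty_iff\<close>)
  moreover have "wp prog_step (\<lambda>t s'. t \<le> 27 * d + 10 \<and> (\<exists>n'<n. ?I n' s')) s"
    if I: "?I n s" and p: "bval ?p s" for n s
  proof -
    from I obtain F' F where F: "represents d f F s" "dominated f d F"
      "real_var s ''n0'' = real (card F')" "n = card F + (if F = F' then 0 else 1)"
      by blast
    have "F \<noteq> F'" and fin: "finite F"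
      using F p finite_subset by (auto simp: represents_def)
    moreover have "card (shrink f F) < card F" if "shrink f F \<noteq> F"
      using that fin shrink_subset by (intro psubset_card_mono) auto
    ultimately have less: "card (shrink f F) + (if shrink f F = F then 0 else 1) < n"
      using F(4) by auto
    show ?thesis
    proof (rule wp_mono[OF wp_prog_step[OF F(1)]], elim conjE, intro conjI)
      fix t s'
      assume s': "represents d f (shrink f F) s'" "\<forall>i\<in>F. arr s' ''y'' i = stationary f F i"
        "real_var s' ''n0'' = real (card F)"
      show "\<exists>n'<n. ?I n' s'"
        by (intro exI[of _ "card (shrink f F) + (if shrink f F = F then 0 else 1)"] conjI less
            exI[of _ F] exI[of _ "shrink f F"] s' dominated_shrink F(2) refl disjI2 fin)
    qed
  qed
  ultimately have "wp (WHILE ?p DO prog_step)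
    (\<lambda>t s'. t \<le> (d + 1) * (bcost ?p + (27 * d + 10)) + bcost ?p \<and> (\<exists>n. ?I n s') \<and> \<not> bval ?p s') s"
    by (intro wp_While[where I = ?I])
  then show ?thesis
  proof (rule wp_mono, elim conjE exE, intro conjI)
    fix t s' n F' F
    assume F: "represents d f F s'" "dominated f d F" "real_var s' ''n0'' = real (card F')"
      "F' = {} \<and> F = {..<d} \<or>
         finite F' \<and> F = shrink f F' \<and> (\<forall>i\<in>F'. arr s' ''y'' i = stationary f F' i)"
      and "\<not> bval ?p s'"
    then have "card F' = card F"
      by (simp add: represents_def)
    then have "F' = F" "shrink f F = F" "\<forall>i\<in>F. arr s' ''y'' i = stationary f F i"
      using F(4) assms(3) card_subset_eq[OF _ shrink_subset[of f F']] by auto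
    then show "\<exists>F. dominated f d F \<and> shrink f F = F \<and> represents d f F s' \<and>
        (\<forall>i\<in>F. arr s' ''y'' i = stationary f F i)"
      using F by blast
  qed (simp add: algebra_simps)
qed

lemma active_set_prog_correct:
  assumes "holds_input s d b" "d \<ge> 1"
  obtains t s' F where "(active_set_prog, s) \<Rightarrow> t \<Down> s'" "dominated (($) b) d F" "shrink (($) b) F = F"
    "output_of s' d = candidate d (($) b) F" "t \<le> 27 * d\<^sup>2 + 51 * d + 19"
proof -
  let ?Q = "\<lambda>t s'. t \<le> 27 * d\<^sup>2 + 51 * d + 19 \<and>
    (\<exists>F. dominated (($) b) d F \<and> shrink (($) b) F = F \<and> output_of s' d = candidate d (($) b) F)"
  \<comment> \<open>The loop bound expands to \<open>27 * d^2 + 38 * d + 12\<close>; initialisation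
    and output add \<open>13 * d + 7\<close>.\<close>
  have time: "t + u + v \<le> 27 * d\<^sup>2 + 51 * d + 19"
    if "t \<le> 8 * d + 5" "u \<le> (d + 1) * (27 * d + 11) + 1" "v \<le> 5 * d + 2" for t u v :: nat
    using that by (simp add: power2_eq_square algebra_simps)
  have "wp active_set_prog ?Q s"
    unfolding active_set_prog_eq wp_Seq
  proof (rule wp_mono[OF wp_prog_init[of s d "($) b"]], goal_cases)
    case (3 t s1)
    then have s1: "represents d (($) b) {..<d} s1" "real_var s1 ''n0'' = 0" "t \<le> 8 * d + 5"
      by simp_all
    show ?case
    proof (rule wp_mono[OF wp_prog_loop[OF s1(1,2) assms(2)]], elim conjE exE)
      fix u s2 F
      assume u: "u \<le> (d + 1) * (27 * d + 11) + 1"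
        and F: "dominated (($) b) d F" "shrink (($) b) F = F"
        and s2: "represents d (($) b) F s2" "\<forall>i\<in>F. arr s2 ''y'' i = stationary (($) b) F i"
      show "wp prog_output (\<lambda>v. ?Q (t + u + v)) s2"
        by (rule wp_mono[OF wp_prog_output[OF s2]]) (use time[OF s1(3) u] F in blast)
    qed
  qed (use assms in \<open>auto simp: holds_input_def\<close>)
  then show ?thesis
    using that by (auto simp: wp_def)
qed

theorem corollary3p6:
  "\<exists>C::real. C > 0 \<and>
     (\<forall>(d::nat) (b::real vec). d \<ge> 1 \<longrightarrow> b \<in> carrier_vec d \<longrightarrow>
       (\<exists>x. active_set d b = Some x \<and>
            optimal_solution d b x \<and> (\<forall>z. optimal_solution d b z \<longrightarrow> z = x) \<and>
            (\<forall>s. holds_input s d b \<longrightarrow>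
              (\<exists>t s'. (active_set_prog, s) \<Rightarrow> t \<Down> s' \<and> output_of s' d = x \<and>
                      real t \<le> C * (real d)\<^sup>2))))"
\<comment> \<open>\<open>97 = 27 + 51 + 19\<close>, since both \<open>d\<close> and 1 are at most
  \<open>d^2\<close> for \<open>d >= 1\<close>.\<close>
proof (intro exI[of _ 97] conjI allI impI)
  fix d :: nat and b :: "real vec"
  assume d: "d \<ge> 1" and b: "b \<in> carrier_vec d"
  obtain F where F: "dominated (($) b) d F" "shrink (($) b) F = F"
    and run: "active_set d b = Some (candidate d (($) b) F)"
    using active_set_eq_candidate[OF d] .
  let ?x = "candidate d (($) b) F"
  have unique: "z = ?x" if "optimal_solution d b z" for z
    by (rule optimal_unique[OF F b that])
  have "\<exists>t s'. (active_set_prog, s) \<Rightarrow> t \<Down> s' \<and> output_of s' d = ?x \<and> real t \<le> 97 * (real d)\<^sup>2"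
    if s: "holds_input s d b" for s
  proof -
    obtain t s' F' where F': "dominated (($) b) d F'" "shrink (($) b) F' = F'"
      and exec: "(active_set_prog, s) \<Rightarrow> t \<Down> s'" "output_of s' d = candidate d (($) b) F'"
      and time: "t \<le> 27 * d\<^sup>2 + 51 * d + 19"
      using active_set_prog_correct[OF s d] .
    have "d \<le> d\<^sup>2" "1 \<le> d\<^sup>2"
      using d by (auto simp: power2_eq_square)
    then have "t \<le> 97 * d\<^sup>2"
      using time by linarith
    then have "real t \<le> 97 * (real d)\<^sup>2"
      by (metis of_nat_le_iff of_nat_mult of_nat_numeral of_nat_power)
    \<comment> \<open>\<open>F'\<close> comes from the program and \<open>F\<close> from the
      set-based run; uniqueness of the optimum equates their candidates.\<close>
    then show ?thesis
      using exec unique[OF candidate_optimal[OF F' b]] by metis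
  qed
  then show "\<exists>x. active_set d b = Some x \<and>
      optimal_solution d b x \<and> (\<forall>z. optimal_solution d b z \<longrightarrow> z = x) \<and>
      (\<forall>s. holds_input s d b \<longrightarrow>
        (\<exists>t s'. (active_set_prog, s) \<Rightarrow> t \<Down> s' \<and> output_of s' d = x \<and>
                real t \<le> 97 * (real d)\<^sup>2))"
    using run candidate_optimal[OF F b] unique by blast
qed simp

end
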